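(* Consider the online setting on $k\ge2$ vertices with the metric $\ell_{ij}=1$ for all $i\ne j$, and with demand sequences $d=(d^1,\dots,d^T)$ whose average drift is bounded by $\delta\le 1$, i.e. $\sum_{t=2}^T\frac12\|d^t-d^{t-1}\|_1\le\delta T$. No online algorithm (randomized algorithms included) has a competitive ratio better (greater) than $1-\delta/4$.
   Context: $V$ is a set of $k$ vertices with distances $\ell_{ij}$. Time steps are $1,\dots,T$. Demand sequences $d=(d^1,\dots,d^T)$ and supply sequences $s=(s^1,\dots,s^T)$ consist of nonnegative vectors indexed by $V$ with entries summing to $1$. The demand served at time $t$ is $\mathrm{ds}(s^t,d^t)=\sum_i\min(s^t_i,d^t_i)$. The earthmover distance $\mathrm{em}(s,s')$ is the minimum of $\sum_{u,v}f(u,v)\ell_{uv}$ over all $f\ge 0$ with $\sum_v f(u,v)=s_u$, $\sum_u f(u,v)=s'_v$. The social welfare is $\mathrm{sw}(s,d)=\sum_{t=1}^T\mathrm{ds}(s^t,d^t)-\sum_{t=2}^T\mathrm{em}(s^{t-1},s^t)$. An online algorithm $\mathrm{Alg}$ chooses $s^t$ as a (possibly randomized) function of $d^1,\dots,d^t$. Its competitive ratio is the worst case (infimum), over demand sequences $d$ in the considered class (of any length $T$), of $\mathrm{sw}(\mathrm{Alg}(d),d)/\max_s\mathrm{sw}(s,d)$, with the numerator replaced by its expectation for randomized algorithms. *)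

theory Defs
  imports "HOL-Probability.Probability"
begin

definition prob_vectors :: "(real ^ 'v::finite) set" where
  "prob_vectors = {x. (\<forall>i. 0 \<le> x $ i) \<and> (\<Sum>i\<in>UNIV. x $ i) = 1}"

definition demand_served :: "real ^ 'v::finite \<Rightarrow> real ^ 'v \<Rightarrow> real" where
  "demand_served s d = (\<Sum>i\<in>UNIV. min (s $ i) (d $ i))"

definition transport_plans ::
    "real ^ 'v::finite \<Rightarrow> real ^ 'v \<Rightarrow> ('v \<Rightarrow> 'v \<Rightarrow> real) set" where
  "transport_plans s s' = {f. (\<forall>u v. 0 \<le> f u v) \<and>
     (\<forall>u. (\<Sum>v\<in>UNIV. f u v) = s $ u) \<and> (\<forall>v. (\<Sum>u\<in>UNIV. f u v) = s' $ v)}"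

text \<open>For probability vectors the set of transport plans is nonempty and compact,
  so the infimum is a minimum.\<close>

definition earthmover ::
    "('v \<Rightarrow> 'v \<Rightarrow> real) \<Rightarrow> real ^ 'v::finite \<Rightarrow> real ^ 'v \<Rightarrow> real" where
  "earthmover l s s' = (INF f\<in>transport_plans s s'. \<Sum>u\<in>UNIV. \<Sum>v\<in>UNIV. f u v * l u v)"

text \<open>A sequence \<open>x\<^sup>1, \<dots>, x\<^sup>T\<close> is a list of length \<open>T\<close>, so \<open>x\<^sup>t\<close> is \<open>x ! (t - 1)\<close>.\<close>

definition social_welfare ::
    "('v \<Rightarrow> 'v \<Rightarrow> real) \<Rightarrow> (real ^ 'v::finite) list \<Rightarrow> (real ^ 'v) list \<Rightarrow> real" where
  "social_welfare l s d =
     (\<Sum>t = 1..length d. demand_served (s ! (t - 1)) (d ! (t - 1))) -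
     (\<Sum>t = 2..length d. earthmover l (s ! (t - 2)) (s ! (t - 1)))"

text \<open>The welfare is continuous in the supply sequence, which ranges over a nonempty
  compact set, so the supremum is a maximum.\<close>

definition optimal_welfare ::
    "('v \<Rightarrow> 'v \<Rightarrow> real) \<Rightarrow> (real ^ 'v::finite) list \<Rightarrow> real" where
  "optimal_welfare l d =
     (SUP s\<in>{s. length s = length d \<and> set s \<subseteq> prob_vectors}. social_welfare l s d)"

text \<open>A randomized online algorithm draws a random seed \<open>\<omega>\<close> from a probability space
  \<open>M\<close>; given the seed, the supply at time \<open>t\<close> is a function of \<open>[d\<^sup>1, \<dots>, d\<^sup>t]\<close> alone.
  Deterministic algorithms are those with \<open>A\<close> independent of the seed.\<close>

definition online_algorithm ::
    "'w measure \<Rightarrow> ('w \<Rightarrow> (real ^ 'v::finite) list \<Rightarrow> real ^ 'v) \<Rightarrow> bool" where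
  "online_algorithm M A \<longleftrightarrow> prob_space M \<and>
     (\<forall>h. h \<noteq> [] \<and> set h \<subseteq> prob_vectors \<longrightarrow>
        (\<lambda>\<omega>. A \<omega> h) \<in> borel_measurable M \<and> (\<forall>\<omega>\<in>space M. A \<omega> h \<in> prob_vectors))"

definition online_supply ::
    "((real ^ 'v::finite) list \<Rightarrow> real ^ 'v) \<Rightarrow> (real ^ 'v) list \<Rightarrow> (real ^ 'v) list" where
  "online_supply a d = map (\<lambda>t. a (take t d)) [1..<Suc (length d)]"

text \<open>The infimum is taken in \<^typ>\<open>ereal\<close>, where it always exists.\<close>

definition competitive_ratio ::
    "('v \<Rightarrow> 'v \<Rightarrow> real) \<Rightarrow> (real ^ 'v::finite) list set \<Rightarrow> 'w measure \<Rightarrow>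
     ('w \<Rightarrow> (real ^ 'v) list \<Rightarrow> real ^ 'v) \<Rightarrow> ereal" where
  "competitive_ratio l D M A =
     (INF d\<in>D. ereal ((\<integral>\<omega>. social_welfare l (online_supply (A \<omega>) d) d \<partial>M)
                       / optimal_welfare l d))"

definition drift_bounded_demands :: "real \<Rightarrow> (real ^ 'v::finite) list set" where
  "drift_bounded_demands \<delta> = {d. d \<noteq> [] \<and> set d \<subseteq> prob_vectors \<and>
     (\<Sum>t = 2..length d. (1/2) * (\<Sum>i\<in>UNIV. \<bar>(d ! (t - 1)) $ i - (d ! (t - 2)) $ i\<bar>))
       \<le> \<delta> * real (length d)}"

definition uniform_metric :: "'v \<Rightarrow> 'v \<Rightarrow> real" where
  "uniform_metric i j = (if i = j then 0 else 1)"

end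

theory Submission
  imports Defs
begin

text \<open>The adversary alternates between two vertices in blocks of \<open>m + 3 \<approx> 2 / \<delta>\<close> (at least \<open>3\<close>) steps:
  \<open>m + 2\<close> unit demands at \<open>c\<close>, then one at the other vertex. Choosing for \<open>c\<close> the vertex where
  the algorithm has at most half its mass in expectation costs the algorithm \<open>1/2\<close> at the start of
  the block, and the last two steps cost it \<open>1\<close> more, whatever it does. A block has drift at
  most \<open>2\<close> and the optimum loses only \<open>1\<close> on it, so the ratio tends to at most
  \<open>(m + 3/2) / (m + 2) \<le> 1 - \<delta> / 4\<close>.\<close>

section \<open>Probability vectors and served demand\<close>

lemma prob_vectorsD:
  assumes "s \<in> prob_vectors"
  shows "0 \<le> s $ i" and "(\<Sum>i\<in>UNIV. s $ i) = 1"
  using assms by (auto simp: prob_vectors_def)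

lemma prob_vectors_sum_le_1:
  assumes "s \<in> prob_vectors"
  shows "(\<Sum>i\<in>I. s $ i) \<le> 1"
proof -
  have "(\<Sum>i\<in>I. s $ i) \<le> (\<Sum>i\<in>UNIV. s $ i)"
    by (rule sum_mono2) (auto simp: prob_vectorsD[OF assms])
  then show ?thesis by (simp add: prob_vectorsD[OF assms])
qed

lemma prob_vectors_nth_le_1: "s \<in> prob_vectors \<Longrightarrow> s $ i \<le> 1"
  using prob_vectors_sum_le_1[of s "{i}"] by simp

lemma prob_vectors_nth_add_le_1: "s \<in> prob_vectors \<Longrightarrow> i \<noteq> j \<Longrightarrow> s $ i + s $ j \<le> 1"
  using prob_vectors_sum_le_1[of s "{i, j}"] by simp

lemma axis_in_prob_vectors [simp]: "axis i 1 \<in> prob_vectors"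
  by (simp add: prob_vectors_def axis_def)

lemma demand_served_axis:
  assumes "s \<in> prob_vectors"
  shows "demand_served s (axis v 1) = s $ v"
proof -
  have "demand_served s (axis v 1) = (\<Sum>i\<in>UNIV. if i = v then s $ i else 0)"
    unfolding demand_served_def
    by (rule sum.cong)
      (use prob_vectorsD(1)[OF assms] prob_vectors_nth_le_1[OF assms] in
        \<open>auto simp: axis_def min_def intro: antisym\<close>)
  then show ?thesis by simp
qed

lemma demand_served_le_1:
  assumes "s \<in> prob_vectors"
  shows "demand_served s d \<le> 1"
proof -
  have "demand_served s d \<le> (\<Sum>i\<in>UNIV. s $ i)"
    unfolding demand_served_def by (rule sum_mono) simp
  then show ?thesis by (simp add: prob_vectorsD[OF assms])
qed

section \<open>The earthmover distance under the uniform metric\<close>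

lemma product_plan:
  assumes "s \<in> prob_vectors" and "s' \<in> prob_vectors"
  shows "(\<lambda>u v. s $ u * s' $ v) \<in> transport_plans s s'"
  using assms
  by (auto simp: transport_plans_def prob_vectorsD
      simp flip: sum_distrib_left sum_distrib_right)

lemma earthmover_le:
  assumes "f \<in> transport_plans s s'"
  shows "earthmover uniform_metric s s' \<le> (\<Sum>u\<in>UNIV. \<Sum>v\<in>UNIV. f u v * uniform_metric u v)"
  unfolding earthmover_def
proof (rule cINF_lower[OF _ assms])
  \<comment> \<open>A real infimum is a lower bound only for a set bounded below; 0 works because
    plans and metric are nonnegative.\<close>
  show "bdd_below ((\<lambda>f. \<Sum>u\<in>UNIV. \<Sum>v\<in>UNIV. f u v * uniform_metric u v) ` transport_plans s s')"
    by (rule bdd_belowI[of _ 0])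
      (auto simp: transport_plans_def uniform_metric_def intro!: sum_nonneg)
qed

lemma earthmover_le_1:
  assumes "s \<in> prob_vectors" and "s' \<in> prob_vectors"
  shows "earthmover uniform_metric s s' \<le> 1"
proof -
  have "earthmover uniform_metric s s'
      \<le> (\<Sum>u\<in>UNIV. \<Sum>v\<in>UNIV. s $ u * s' $ v * uniform_metric u v)"
    by (rule earthmover_le[OF product_plan[OF assms]])
  also have "\<dots> \<le> (\<Sum>u\<in>UNIV. \<Sum>v\<in>UNIV. s $ u * s' $ v)"
    by (intro sum_mono) (auto simp: uniform_metric_def assms prob_vectorsD(1))
  also have "\<dots> = 1"
    by (simp add: prob_vectorsD(2) assms flip: sum_distrib_left sum_distrib_right)
  finally show ?thesis .
qed

lemma earthmover_self_le_0:
  assumes "s \<in> prob_vectors"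
  shows "earthmover uniform_metric s s \<le> 0"
proof -
  have "(\<lambda>u v. if u = v then s $ u else 0) \<in> transport_plans s s"
    by (auto simp: transport_plans_def prob_vectorsD(1)[OF assms])
  from earthmover_le[OF this]
  have "earthmover uniform_metric s s
      \<le> (\<Sum>u\<in>UNIV. \<Sum>v\<in>UNIV. (if u = v then s $ u else 0) * uniform_metric u v)" .
  also have "\<dots> = 0"
    by (intro sum.neutral ballI) (simp add: uniform_metric_def)
  finally show ?thesis .
qed

text \<open>At most \<open>s $ w\<close> of the mass required at \<open>w\<close> can already be
  there. The rest arrives from other vertices, at unit cost in every plan.\<close>

lemma earthmover_ge:
  assumes "s \<in> prob_vectors" and "s' \<in> prob_vectors"
  shows "s' $ w - s $ w \<le> earthmover uniform_metric s s'"
  unfolding earthmover_def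
proof (rule cINF_greatest)
  show "transport_plans s s' \<noteq> {}"
    using product_plan[OF assms] by blast
next
  fix f assume "f \<in> transport_plans s s'"
  then have nonneg: "\<And>u v. 0 \<le> f u v" and out: "\<And>u. (\<Sum>v\<in>UNIV. f u v) = s $ u"
    and inn: "\<And>v. (\<Sum>u\<in>UNIV. f u v) = s' $ v"
    by (auto simp: transport_plans_def)
  have "f w w \<le> (\<Sum>v\<in>UNIV. f w v)"
    by (rule member_le_sum) (auto simp: nonneg)
  then have "f w w \<le> s $ w" by (simp add: out)
  moreover have "s' $ w = f w w + (\<Sum>u\<in>UNIV - {w}. f u w)"
    by (simp add: sum.remove flip: inn)
  moreover have "(\<Sum>u\<in>UNIV - {w}. f u w) \<le> (\<Sum>u\<in>UNIV. \<Sum>v\<in>UNIV. f u v * uniform_metric u v)"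
  proof -
    have "(\<Sum>u\<in>UNIV - {w}. f u w) = (\<Sum>u\<in>UNIV - {w}. f u w * uniform_metric u w)"
      by (rule sum.cong) (auto simp: uniform_metric_def)
    also have "\<dots> \<le> (\<Sum>u\<in>UNIV. f u w * uniform_metric u w)"
      by (rule sum_mono2) (auto simp: nonneg uniform_metric_def)
    also have "\<dots> \<le> (\<Sum>u\<in>UNIV. \<Sum>v\<in>UNIV. f u v * uniform_metric u v)"
      by (intro sum_mono member_le_sum[where f = "\<lambda>v. f _ v * uniform_metric _ v"])
        (auto simp: nonneg uniform_metric_def)
    finally show ?thesis .
  qed
  ultimately show "s' $ w - s $ w \<le> (\<Sum>u\<in>UNIV. \<Sum>v\<in>UNIV. f u v * uniform_metric u v)"
    by linarith
qed

lemma earthmover_nonneg: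
  assumes "s \<in> prob_vectors" and "s' \<in> prob_vectors"
  shows "0 \<le> earthmover uniform_metric s s'"
proof -
  \<comment> \<open>Equal total masses forbid \<open>s'\<close> from being smaller everywhere; at
    such a \<open>w\<close> the bound of \<open>earthmover_ge\<close> is nonnegative.\<close>
  have "\<exists>w. s $ w \<le> s' $ w"
  proof (rule ccontr)
    assume "\<not> ?thesis"
    then have "(\<Sum>w\<in>UNIV. s' $ w) < (\<Sum>w\<in>UNIV. s $ w)"
      by (intro sum_strict_mono) (auto simp: not_le)
    then show False by (simp add: prob_vectorsD(2) assms)
  qed
  then show ?thesis
    using earthmover_ge[OF assms] by (meson diff_ge_0_iff_ge order_trans)
qed

section \<open>Welfare of sequences extended by one step, and the optimum\<close>

text \<open>Stated for an arbitrary \<open>g\<close> so that it serves both the movement cost and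
  the drift. For empty \<open>xs\<close> there is no consecutive pair, and the extra term would be
  spurious.\<close>

lemma sum_consecutive_snoc:
  assumes "xs \<noteq> []"
  shows "(\<Sum>t = 2..length (xs @ [x]). g ((xs @ [x]) ! (t - 2)) ((xs @ [x]) ! (t - 1)))
    = (\<Sum>t = 2..length xs. g (xs ! (t - 2)) (xs ! (t - 1))) + (g (last xs) x :: real)"
proof -
  have "2 \<le> Suc (length xs)" using assms by (cases xs) auto
  moreover have "(\<Sum>t = 2..length xs. g ((xs @ [x]) ! (t - 2)) ((xs @ [x]) ! (t - 1)))
      = (\<Sum>t = 2..length xs. g (xs ! (t - 2)) (xs ! (t - 1)))"
    by (rule sum.cong) (auto simp: nth_append)
  moreover have "(xs @ [x]) ! (length xs - 1) = last xs"
    using assms by (simp add: nth_append last_conv_nth)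
  ultimately show ?thesis
    using assms by (simp add: sum.cl_ivl_Suc)
qed

lemma social_welfare_snoc:
  assumes "length s = length d" and "d \<noteq> []"
  shows "social_welfare l (s @ [x]) (d @ [e])
    = social_welfare l s d + demand_served x e - earthmover l (last s) x"
proof -
  have "s \<noteq> []" using assms by auto
  have "(\<Sum>t = 1..length d. demand_served ((s @ [x]) ! (t - 1)) ((d @ [e]) ! (t - 1)))
      = (\<Sum>t = 1..length d. demand_served (s ! (t - 1)) (d ! (t - 1)))"
    by (rule sum.cong) (use assms in \<open>auto simp: nth_append\<close>)
  moreover have "(s @ [x]) ! length d = x" using assms(1) by (metis nth_append_length)
  ultimately have "(\<Sum>t = 1..length (d @ [e]). demand_served ((s @ [x]) ! (t - 1)) ((d @ [e]) ! (t - 1)))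
      = (\<Sum>t = 1..length d. demand_served (s ! (t - 1)) (d ! (t - 1))) + demand_served x e"
    by simp
  with sum_consecutive_snoc[OF \<open>s \<noteq> []\<close>, of "earthmover l" x] show ?thesis
    by (simp add: social_welfare_def assms(1))
qed

lemma social_welfare_singleton [simp]: "social_welfare l [x] [e] = demand_served x e"
  by (simp add: social_welfare_def)

text \<open>Provides the upper bound that makes the supremum in \<open>optimal_welfare\<close>
  meaningful over the reals.\<close>

lemma social_welfare_le_length:
  assumes "length s = length d" and "set s \<subseteq> prob_vectors"
  shows "social_welfare uniform_metric s d \<le> real (length d)"
proof -
  have mem: "s ! i \<in> prob_vectors" if "i < length d" for i
    using assms nth_mem[of i s] that by auto
  have "(\<Sum>t = 1..length d. demand_served (s ! (t - 1)) (d ! (t - 1))) \<le> (\<Sum>t = 1..length d. 1)"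
    by (intro sum_mono demand_served_le_1 mem) auto
  moreover have "0 \<le> (\<Sum>t = 2..length d. earthmover uniform_metric (s ! (t - 2)) (s ! (t - 1)))"
    by (intro sum_nonneg earthmover_nonneg mem) auto
  ultimately show ?thesis
    unfolding social_welfare_def by simp
qed

lemma optimal_welfare_ge:
  assumes "length s = length d" and "set s \<subseteq> prob_vectors"
  shows "social_welfare uniform_metric s d \<le> optimal_welfare uniform_metric d"
  unfolding optimal_welfare_def
proof (rule cSUP_upper)
  show "bdd_above ((\<lambda>s. social_welfare uniform_metric s d) `
      {s. length s = length d \<and> set s \<subseteq> prob_vectors})"
    by (rule bdd_aboveI[of _ "real (length d)"]) (auto intro: social_welfare_le_length)
qed (use assms in simp)

section \<open>Online supplies and welfare bounds for a fixed seed\<close>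

lemma online_supply_singleton [simp]: "online_supply a [e] = [a [e]]"
  by (simp add: online_supply_def)

lemma length_online_supply [simp]: "length (online_supply a d) = length d"
  by (simp add: online_supply_def del: upt_Suc)

text \<open>This is where being online enters: a new demand leaves all earlier supplies
  unchanged.\<close>

lemma online_supply_snoc: "online_supply a (d @ [e]) = online_supply a d @ [a (d @ [e])]"
  by (auto simp: online_supply_def)

lemma last_online_supply: "d \<noteq> [] \<Longrightarrow> last (online_supply a d) = a d"
  by (cases d rule: rev_cases) (simp_all add: online_supply_snoc)

definition online_welfare :: "((real ^ 'v::finite) list \<Rightarrow> real ^ 'v) \<Rightarrow> (real ^ 'v) list \<Rightarrow> real" where
  "online_welfare a d = social_welfare uniform_metric (online_supply a d) d"

lemma online_welfare_snoc:
  assumes "d \<noteq> []"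
  shows "online_welfare a (d @ [e]) = online_welfare a d
    + demand_served (a (d @ [e])) e - earthmover uniform_metric (a d) (a (d @ [e]))"
  using assms
  by (simp add: online_welfare_def online_supply_snoc social_welfare_snoc last_online_supply)

text \<open>Serving a demand at \<open>v\<close> beyond the mass already present at \<open>v\<close> is paid for by the movement.\<close>

lemma online_welfare_snoc_axis_le:
  assumes "d \<noteq> []" and "a d \<in> prob_vectors" and "a (d @ [axis v 1]) \<in> prob_vectors"
  shows "online_welfare a (d @ [axis v 1]) \<le> online_welfare a d + a d $ v"
  using online_welfare_snoc[OF assms(1), of a "axis v 1"]
    earthmover_ge[OF assms(2,3), of v] demand_served_axis[OF assms(3), of v]
  by linarith

text \<open>Let \<open>p\<close> be the supply at the first of the two steps. That step gains at
  most \<open>p $ v\<close>, and the second is charged to the mass \<open>p $ w\<close> already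
  present; distinct vertices share at most one unit.\<close>

lemma online_welfare_snoc_two_axes_le:
  assumes "d \<noteq> []" and "v \<noteq> w" and "a d \<in> prob_vectors" and "a (d @ [axis v 1]) \<in> prob_vectors"
    and "a (d @ [axis v 1, axis w 1]) \<in> prob_vectors"
  shows "online_welfare a (d @ [axis v 1, axis w 1]) \<le> online_welfare a d + 1"
proof -
  have "online_welfare a (d @ [axis v 1, axis w 1])
      \<le> online_welfare a (d @ [axis v 1]) + a (d @ [axis v 1]) $ w"
    using online_welfare_snoc_axis_le[of "d @ [axis v 1]" a w] assms by simp
  also have "\<dots> \<le> online_welfare a d + a (d @ [axis v 1]) $ v + a (d @ [axis v 1]) $ w"
    using online_welfare_snoc[OF assms(1), of a "axis v 1"]
      earthmover_nonneg[OF assms(3,4)] demand_served_axis[OF assms(4), of v]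
    by linarith
  also have "\<dots> \<le> online_welfare a d + 1"
    using prob_vectors_nth_add_le_1[OF assms(4,2)] by linarith
  finally show ?thesis .
qed

section \<open>Drift, and welfare while a demand is repeated\<close>

definition drift :: "(real ^ 'v::finite) list \<Rightarrow> real" where
  "drift d = (\<Sum>t = 2..length d. (1/2) * (\<Sum>i\<in>UNIV. \<bar>(d ! (t - 1)) $ i - (d ! (t - 2)) $ i\<bar>))"

lemma drift_snoc:
  "d \<noteq> [] \<Longrightarrow> drift (d @ [e]) = drift d + (1/2) * (\<Sum>i\<in>UNIV. \<bar>e $ i - last d $ i\<bar>)"
  unfolding drift_def
  by (rule sum_consecutive_snoc[where g = "\<lambda>x y. (1/2) * (\<Sum>i\<in>UNIV. \<bar>y $ i - x $ i\<bar>)"])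

text \<open>For nonnegative entries the absolute difference is at most the sum, so two probability
  vectors are at distance at most 2 in the 1-norm, which the drift halves.\<close>

lemma drift_snoc_le:
  assumes "d \<noteq> []" and "set d \<subseteq> prob_vectors" and "e \<in> prob_vectors"
  shows "drift (d @ [e]) \<le> drift d + 1"
proof -
  have mem: "last d \<in> prob_vectors" using assms by auto
  have "(\<Sum>i\<in>UNIV. \<bar>e $ i - last d $ i\<bar>) \<le> (\<Sum>i\<in>UNIV. e $ i + last d $ i)"
    by (intro sum_mono) (use prob_vectorsD(1)[OF mem] prob_vectorsD(1)[OF assms(3)] in
        \<open>auto simp: abs_le_iff intro: order_trans add_increasing\<close>)
  also have "\<dots> = 2"
    by (simp add: sum.distrib prob_vectorsD(2) mem assms(3))
  finally show ?thesis using drift_snoc[OF assms(1), of e] by simp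
qed

lemma drift_append_replicate: "d \<noteq> [] \<Longrightarrow> drift (d @ replicate k (last d)) = drift d"
proof (induction k)
  case (Suc k)
  then have "last (d @ replicate k (last d)) = last d" by (cases k) (auto simp: last_append)
  with Suc drift_snoc[of "d @ replicate k (last d)" "last d"]
  show ?case by (simp flip: replicate_append_same)
qed simp

text \<open>A player parked at the repeated demand gains 1 per step without moving. As
  \<open>last s\<close> is the axis vector of \<open>v\<close>, it serves as both supply and
  demand.\<close>

lemma social_welfare_append_replicate:
  assumes "length s = length d" and "d \<noteq> []" and "last s = axis v 1"
  shows "social_welfare uniform_metric s d + real k
    \<le> social_welfare uniform_metric (s @ replicate k (last s)) (d @ replicate k (last s))"
proof (induction k)
  case (Suc k)
  have "last (s @ replicate k (last s)) = last s" by (cases k) (auto simp: last_append)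
  then have "social_welfare uniform_metric (s @ replicate (Suc k) (last s)) (d @ replicate (Suc k) (last s))
    = social_welfare uniform_metric (s @ replicate k (last s)) (d @ replicate k (last s))
      + demand_served (last s) (last s) - earthmover uniform_metric (last s) (last s)"
    using social_welfare_snoc[of "s @ replicate k (last s)" "d @ replicate k (last s)"
        uniform_metric "last s" "last s"] assms
    by (simp flip: replicate_append_same)
  moreover have "demand_served (last s) (last s) = 1"
    by (simp add: assms(3) demand_served_axis)
  moreover have "earthmover uniform_metric (last s) (last s) \<le> 0"
    by (simp add: assms(3) earthmover_self_le_0)
  ultimately show ?case using Suc by simp
qed simp

section \<open>Expected welfare of a randomized online algorithm\<close>

context
  fixes M :: "'w measure" and A :: "'w \<Rightarrow> (real ^ 'v::finite) list \<Rightarrow> real ^ 'v"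
  assumes online: "online_algorithm M A"
begin

interpretation prob_space M
  using online by (simp add: online_algorithm_def)

lemma online_supply_in_prob_vectors:
  "d \<noteq> [] \<Longrightarrow> set d \<subseteq> prob_vectors \<Longrightarrow> \<omega> \<in> space M \<Longrightarrow> A \<omega> d \<in> prob_vectors"
  using online by (simp add: online_algorithm_def)

lemma integrable_supply:
  assumes "d \<noteq> []" and "set d \<subseteq> prob_vectors"
  shows "integrable M (\<lambda>\<omega>. A \<omega> d $ v)"
proof (rule integrable_const_bound[where B = 1])
  have "(\<lambda>\<omega>. A \<omega> d) \<in> borel_measurable M"
    using online assms by (simp add: online_algorithm_def)
  then show "(\<lambda>\<omega>. A \<omega> d $ v) \<in> borel_measurable M"
    by (rule measurable_compose) (intro borel_measurable_continuous_onI continuous_intros)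
  show "AE \<omega> in M. norm (A \<omega> d $ v) \<le> 1"
    using online_supply_in_prob_vectors[OF assms]
    by (intro AE_I2) (simp add: prob_vectorsD(1) prob_vectors_nth_le_1)
qed

text \<open>Working with integrable majorants avoids the measurability of the earthmover distance.\<close>

definition welfare_bound :: "(real ^ 'v) list \<Rightarrow> real \<Rightarrow> bool" where
  "welfare_bound d B \<longleftrightarrow> (\<exists>U. integrable M U \<and> (\<integral>\<omega>. U \<omega> \<partial>M) \<le> B \<and>
     (\<forall>\<omega>\<in>space M. 0 \<le> U \<omega> \<and> online_welfare (A \<omega>) d \<le> U \<omega>))"

text \<open>Should the welfare fail to be integrable, its integral is 0 by default; the clause
  \<open>0 \<le> U \<omega>\<close> covers that case.\<close>

lemma welfare_boundD:
  assumes "welfare_bound d B"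
  shows "(\<integral>\<omega>. online_welfare (A \<omega>) d \<partial>M) \<le> B"
proof -
  obtain U where U: "integrable M U" "(\<integral>\<omega>. U \<omega> \<partial>M) \<le> B"
    "\<And>\<omega>. \<omega> \<in> space M \<Longrightarrow> 0 \<le> U \<omega> \<and> online_welfare (A \<omega>) d \<le> U \<omega>"
    using assms by (auto simp: welfare_bound_def)
  have "(\<integral>\<omega>. online_welfare (A \<omega>) d \<partial>M) \<le> (\<integral>\<omega>. U \<omega> \<partial>M)"
    using U by (intro integral_mono') auto
  with U(2) show ?thesis by linarith
qed

text \<open>The per-seed increment \<open>g\<close> is added to the majorant, so linearity of
  expectation is applied to integrable functions only.\<close>

lemma welfare_bound_add:
  assumes "welfare_bound d B" and "integrable M g" and "(\<integral>\<omega>. g \<omega> \<partial>M) \<le> C"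
    and "\<And>\<omega>. \<omega> \<in> space M \<Longrightarrow> 0 \<le> g \<omega>"
    and "\<And>\<omega>. \<omega> \<in> space M \<Longrightarrow> online_welfare (A \<omega>) d' \<le> online_welfare (A \<omega>) d + g \<omega>"
  shows "welfare_bound d' (B + C)"
proof -
  obtain U where U: "integrable M U" "(\<integral>\<omega>. U \<omega> \<partial>M) \<le> B"
    "\<And>\<omega>. \<omega> \<in> space M \<Longrightarrow> 0 \<le> U \<omega> \<and> online_welfare (A \<omega>) d \<le> U \<omega>"
    using assms(1) by (auto simp: welfare_bound_def)
  show ?thesis
    unfolding welfare_bound_def
  proof (intro exI conjI ballI)
    show "integrable M (\<lambda>\<omega>. U \<omega> + g \<omega>)" using U assms by simp
    show "(\<integral>\<omega>. U \<omega> + g \<omega> \<partial>M) \<le> B + C" using U assms by simp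
  next
    fix \<omega> assume "\<omega> \<in> space M"
    then show "0 \<le> U \<omega> + g \<omega>" "online_welfare (A \<omega>) d' \<le> U \<omega> + g \<omega>"
      using U(3) assms(4,5) by force+
  qed
qed

lemma welfare_bound_singleton:
  assumes "e \<in> prob_vectors"
  shows "welfare_bound [e] 1"
  unfolding welfare_bound_def
  by (rule exI[of _ "\<lambda>_. 1"])
    (auto simp: online_welfare_def prob_space
      intro!: demand_served_le_1 online_supply_in_prob_vectors assms)

text \<open>The gain is controlled by the supply for the history \<open>d\<close>, fixed before the
  new demand is revealed. An adversary may therefore choose \<open>v\<close> according to this
  expectation.\<close>

lemma welfare_bound_snoc:
  assumes "welfare_bound d B" and "d \<noteq> []" and "set d \<subseteq> prob_vectors"
    and "(\<integral>\<omega>. A \<omega> d $ v \<partial>M) \<le> C"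
  shows "welfare_bound (d @ [axis v 1]) (B + C)"
  using assms
  by (intro welfare_bound_add[OF assms(1) integrable_supply assms(4)]
      online_welfare_snoc_axis_le)
    (auto intro!: online_supply_in_prob_vectors prob_vectorsD(1))

lemma expected_supply_le_1:
  assumes "d \<noteq> []" and "set d \<subseteq> prob_vectors"
  shows "(\<integral>\<omega>. A \<omega> d $ v \<partial>M) \<le> 1"
proof -
  have "(\<integral>\<omega>. A \<omega> d $ v \<partial>M) \<le> (\<integral>\<omega>. 1 \<partial>M)"
    by (intro integral_mono integrable_supply assms)
      (auto intro!: prob_vectors_nth_le_1 online_supply_in_prob_vectors assms)
  then show ?thesis by (simp add: prob_space)
qed

text \<open>The two expected masses add up to at most 1. Since only expectations are consulted,
  never the seed, the adversary produces one demand sequence valid for all seeds.\<close>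

lemma exists_expected_supply_le_half:
  assumes "d \<noteq> []" and "set d \<subseteq> prob_vectors" and "x \<noteq> y"
  obtains c c' where "{c, c'} = {x, y}" and "(\<integral>\<omega>. A \<omega> d $ c \<partial>M) \<le> 1/2"
proof -
  have "(\<integral>\<omega>. A \<omega> d $ x \<partial>M) + (\<integral>\<omega>. A \<omega> d $ y \<partial>M) = (\<integral>\<omega>. A \<omega> d $ x + A \<omega> d $ y \<partial>M)"
    by (simp add: integrable_supply assms)
  also have "\<dots> \<le> (\<integral>\<omega>. 1 \<partial>M)"
    by (intro integral_mono Bochner_Integration.integrable_add integrable_supply assms)
      (auto intro!: prob_vectors_nth_add_le_1 online_supply_in_prob_vectors assms)
  finally have "(\<integral>\<omega>. A \<omega> d $ x \<partial>M) \<le> 1/2 \<or> (\<integral>\<omega>. A \<omega> d $ y \<partial>M) \<le> 1/2"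
    by (simp add: prob_space) linarith
  then show ?thesis using that[of x y] that[of y x] by auto
qed

section \<open>Blocks of demands and the adversary\<close>

lemma welfare_bound_append_replicate:
  assumes "welfare_bound d B" and "d \<noteq> []" and "set d \<subseteq> prob_vectors"
  shows "welfare_bound (d @ replicate k (axis v 1)) (B + real k)"
proof (induction k)
  case (Suc k)
  have "set (d @ replicate k (axis v 1)) \<subseteq> prob_vectors" using assms by auto
  with welfare_bound_snoc[OF Suc _ _ expected_supply_le_1] assms(2)
  have "welfare_bound ((d @ replicate k (axis v 1)) @ [axis v 1]) (B + real k + 1)" by simp
  then show ?case by (simp add: add_ac flip: replicate_append_same)
qed (use assms in simp)

text \<open>Accounting for the block: 1/2 for the first demand at \<open>c\<close>, 1 for each of
  the next \<open>m\<close>, and 1 in total for the last demand at \<open>c\<close> together with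
  the one at \<open>c'\<close>.\<close>

lemma welfare_bound_append_block:
  assumes "welfare_bound d B" and "d \<noteq> []" and "set d \<subseteq> prob_vectors" and "c \<noteq> c'"
    and "(\<integral>\<omega>. A \<omega> d $ c \<partial>M) \<le> 1/2"
  shows "welfare_bound (d @ replicate (m + 2) (axis c 1) @ [axis c' 1]) (B + real m + 3/2)"
proof -
  \<comment> \<open>One demand at \<open>c\<close> is held back, to be paired with the demand at
    \<open>c'\<close> in the two-step bound.\<close>
  let ?d = "d @ axis c 1 # replicate m (axis c 1)"
  have sub: "set ?d \<subseteq> prob_vectors" using assms(3) by auto
  have "welfare_bound ((d @ [axis c 1]) @ replicate m (axis c 1)) (B + 1/2 + real m)"
    by (intro welfare_bound_append_replicate welfare_bound_snoc assms) (use assms in auto)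
  then have "welfare_bound ?d (B + 1/2 + real m)" by simp
  then have "welfare_bound (?d @ [axis c 1, axis c' 1]) (B + 1/2 + real m + 1)"
    by (rule welfare_bound_add[where g = "\<lambda>_. 1"])
      (use sub assms(4) in \<open>auto simp: prob_space simp del: append_Cons append_assoc
        intro!: online_welfare_snoc_two_axes_le online_supply_in_prob_vectors\<close>)
  moreover have "replicate (m + 2) (axis c 1) = axis c 1 # replicate m (axis c 1) @ [axis c (1::real)]"
    by (simp add: replicate_append_same)
  ultimately show ?thesis by (simp add: add_ac)
qed

text \<open>The last entry of the offline supply is left free, since at the end of a block moving and
  staying cost the same: the offline player then already is wherever the next block starts.\<close>

lemma adversary:
  assumes "x \<noteq> (y :: 'v)"
  shows "\<exists>d s. d \<noteq> [] \<and> set d \<subseteq> prob_vectors \<and> length d = (m + 3) * n + 1 \<and>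
    drift d \<le> 2 * real n \<and> welfare_bound d ((real m + 3/2) * real n + 1) \<and>
    set s \<subseteq> prob_vectors \<and> length d = length s + 1 \<and>
    (\<forall>z\<in>{x, y}. (real m + 2) * real n \<le> social_welfare uniform_metric (s @ [axis z 1]) d)"
proof (induction n)
  \<comment> \<open>The initial demand makes the history nonempty, so that there is a supply to
    inspect. It causes the \<open>+ 1\<close> in the length and in the welfare bound; the offline
    player is credited 0 for it.\<close>
  case 0
  have "drift [axis x (1::real)] = 0" by (simp add: drift_def)
  then show ?case
    by (intro exI[of _ "[axis x 1]"] exI[of _ "[]"])
      (auto simp: demand_served_axis axis_def welfare_bound_singleton[unfolded axis_def]
        demand_served_axis[unfolded axis_def] axis_in_prob_vectors[unfolded axis_def])
next
  case (Suc n)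
  then obtain d s where d: "d \<noteq> []" "set d \<subseteq> prob_vectors" "length d = (m + 3) * n + 1"
    "drift d \<le> 2 * real n" "welfare_bound d ((real m + 3/2) * real n + 1)"
    and s: "set s \<subseteq> prob_vectors" "length d = length s + 1"
    "\<forall>z\<in>{x, y}. (real m + 2) * real n \<le> social_welfare uniform_metric (s @ [axis z 1]) d"
    by blast
  obtain c c' where c: "{c, c'} = {x, y}" "(\<integral>\<omega>. A \<omega> d $ c \<partial>M) \<le> 1/2"
    using exists_expected_supply_le_half[OF d(1,2) assms] by blast
  have "c \<noteq> c'" using c(1) assms by (auto simp: doubleton_eq_iff)
  let ?e = "axis c 1 :: real ^ 'v" and ?e' = "axis c' 1 :: real ^ 'v"
  \<comment> \<open>Filling the free entry of the old supply with \<open>c\<close> puts the offline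
    player in place before the block starts; it then stays for all \<open>m + 2\<close> demands at
    \<open>c\<close>.\<close>
  let ?d = "d @ replicate (m + 2) ?e" and ?s = "(s @ [?e]) @ replicate (m + 2) ?e"
  have len: "length ?s = length ?d" and last: "last ?s = ?e"
    using s(2) by (auto simp: last_append)
  have sw: "(real m + 2) * real (Suc n) \<le> social_welfare uniform_metric ?s ?d"
  proof -
    have "(real m + 2) * real n \<le> social_welfare uniform_metric (s @ [?e]) d"
      using c(1) by (intro s(3)[rule_format]) auto
    moreover have "social_welfare uniform_metric (s @ [?e]) d + real (m + 2)
        \<le> social_welfare uniform_metric ?s ?d"
      using social_welfare_append_replicate[of "s @ [?e]" d c "m + 2"] s(2) d(1) by simp
    ultimately show ?thesis by (simp add: algebra_simps)
  qed
  \<comment> \<open>For \<open>z = c\<close> the player stays, at no cost; for \<open>z = c'\<close>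
    it pays at most 1 and serves 1. Either way nothing is lost, so the new last entry is free
    again.\<close>
  have gain: "social_welfare uniform_metric ?s ?d
      \<le> social_welfare uniform_metric (?s @ [axis z 1]) (?d @ [?e'])" if "z \<in> {c, c'}" for z
  proof -
    have "earthmover uniform_metric ?e (axis z 1) \<le> demand_served (axis z 1) ?e'"
      using that \<open>c \<noteq> c'\<close> earthmover_self_le_0[of ?e] earthmover_le_1[of ?e "axis z 1"]
      by (auto simp: demand_served_axis) (auto simp: axis_def)
    then show ?thesis
      using social_welfare_snoc[OF len, of uniform_metric "axis z 1" ?e'] d(1) last by simp
  qed
  \<comment> \<open>Only two steps of the block can change the demand: the first one, to
    \<open>c\<close>, and the last one, to \<open>c'\<close>.\<close>
  have "drift ?d = drift ((d @ [?e]) @ replicate (m + 1) ?e)" by simp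
  also have "\<dots> = drift (d @ [?e])"
    using drift_append_replicate[of "d @ [?e]" "m + 1"] by simp
  also have "\<dots> \<le> drift d + 1" by (intro drift_snoc_le d) simp
  finally have "drift ?d \<le> drift d + 1" .
  moreover have "set ?d \<subseteq> prob_vectors" using d(2) by auto
  ultimately have "drift (?d @ [?e']) \<le> drift d + 2"
    using drift_snoc_le[of ?d ?e'] d(1) by simp
  then have drift: "drift (?d @ [?e']) \<le> 2 * real (Suc n)" using d(4) by simp
  have "welfare_bound (?d @ [?e']) ((real m + 3/2) * real (Suc n) + 1)"
    using welfare_bound_append_block[OF d(5,1,2) \<open>c \<noteq> c'\<close> c(2), of m]
    by (simp add: algebra_simps add_divide_distrib)
  with drift show ?case
    using d s gain sw c(1) len
    by (intro exI[of _ "?d @ [?e']"] exI[of _ ?s]) (auto intro: order_trans simp del: replicate_add)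
qed

section \<open>From a single demand sequence to the competitive ratio\<close>

lemma competitive_ratio_le:
  assumes "d \<in> drift_bounded_demands \<delta>" and "welfare_bound d B"
    and "length s = length d" and "set s \<subseteq> prob_vectors"
    and "C \<le> social_welfare uniform_metric s d" and "0 < C" and "0 \<le> B"
  shows "competitive_ratio uniform_metric (drift_bounded_demands \<delta>) M A \<le> ereal (B / C)"
proof -
  have "C \<le> optimal_welfare uniform_metric d"
    using optimal_welfare_ge[OF assms(3,4)] assms(5) by linarith
  moreover have "(\<integral>\<omega>. social_welfare uniform_metric (online_supply (A \<omega>) d) d \<partial>M) \<le> B"
    using welfare_boundD[OF assms(2)] by (simp add: online_welfare_def)
  ultimately have "(\<integral>\<omega>. social_welfare uniform_metric (online_supply (A \<omega>) d) d \<partial>M)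
      / optimal_welfare uniform_metric d \<le> B / C"
    \<comment> \<open>Replacing the optimum by its lower bound \<open>C\<close> may only increase
      the quotient because \<open>B\<close> is nonnegative.\<close>
    using assms(6,7) by (intro frac_le)
  then show ?thesis
    unfolding competitive_ratio_def by (intro INF_lower2[OF assms(1)]) simp
qed

end

theorem theorem5p14:
  fixes \<delta> :: real
    and M :: "'w measure"
    and A :: "'w \<Rightarrow> (real ^ 'v::finite) list \<Rightarrow> real ^ 'v"
  assumes "CARD('v) \<ge> 2"
    and "0 \<le> \<delta>" and "\<delta> \<le> 1"
    and "online_algorithm M A"
  shows "competitive_ratio uniform_metric (drift_bounded_demands \<delta>) M A \<le> ereal (1 - \<delta> / 4)"
proof (cases "\<delta> = 0")
  case True
  \<comment> \<open>Here the target is 1: a single step at an arbitrary vertex has no drift, and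
    nobody serves more than 1.\<close>
  let ?d = "[axis undefined 1] :: (real ^ 'v) list"
  have "?d \<in> drift_bounded_demands \<delta>"
    by (simp add: drift_bounded_demands_def True)
  from competitive_ratio_le[OF assms(4) this welfare_bound_singleton[OF assms(4)], of ?d 1]
  show ?thesis by (simp add: True demand_served_axis)
next
  case False
  then have "0 < \<delta>" using assms(2) by simp
  \<comment> \<open>The block length \<open>m + 3\<close> is the least integer at least
    \<open>2 / \<delta>\<close>, so that drift 2 per block is admissible. If
    \<open>\<delta> = 1\<close> that integer is 2 and the truncated subtraction yields blocks of
    length 3; then \<open>2 \<le> 2 / \<delta>\<close> still gives the upper bound on
    \<open>m + 2\<close>.\<close>
  define m where "m = nat \<lceil>2 / \<delta>\<rceil> - 3"
  have "2 / \<delta> \<le> real m + 3"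
    unfolding m_def by linarith
  then have m_ge: "2 \<le> \<delta> * (real m + 3)"
    using \<open>0 < \<delta>\<close> by (simp add: pos_divide_le_eq mult.commute)
  have "2 \<le> 2 / \<delta>" using \<open>0 < \<delta>\<close> assms(3) by (simp add: field_simps)
  then have "real m + 2 \<le> 2 / \<delta>"
    unfolding m_def by linarith
  then have m_le: "\<delta> * (real m + 2) \<le> 2"
    using \<open>0 < \<delta>\<close> by (simp add: pos_le_divide_eq mult.commute)
  obtain x y :: 'v where "x \<noteq> y"
    using assms(1) by (metis card_2_iff' card_le_Suc0_iff_eq finite not_less_eq_eq numeral_2_eq_2 UNIV_I)
  have bound: "competitive_ratio uniform_metric (drift_bounded_demands \<delta>) M A
      \<le> ereal ((real m + 3/2) / (real m + 2) + 1 / (real m + 2) * (1 / real n))" if "1 \<le> n" for n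
  proof -
    obtain d s where d: "d \<noteq> []" "set d \<subseteq> prob_vectors" "length d = (m + 3) * n + 1"
      "drift d \<le> 2 * real n" "welfare_bound M A d ((real m + 3/2) * real n + 1)"
      and s: "set s \<subseteq> prob_vectors" "length d = length s + 1"
      "(real m + 2) * real n \<le> social_welfare uniform_metric (s @ [axis x 1]) d"
      using adversary[OF assms(4) \<open>x \<noteq> y\<close>, of m n] by blast
    have "2 * real n \<le> \<delta> * (real m + 3) * real n"
      using m_ge by (intro mult_right_mono) auto
    \<comment> \<open>The initial demand only adds slack, since it lengthens the sequence by one
      step.\<close>
    also have "\<dots> \<le> \<delta> * real (length d)"
      using assms(2) d(3) by (simp add: algebra_simps)
    finally have "d \<in> drift_bounded_demands \<delta>"
      using d(1,2,4) by (simp add: drift_bounded_demands_def drift_def)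
    from competitive_ratio_le[OF assms(4) this d(5) _ _ s(3)]
    have "competitive_ratio uniform_metric (drift_bounded_demands \<delta>) M A
        \<le> ereal (((real m + 3/2) * real n + 1) / ((real m + 2) * real n))"
      using s that by simp
    also have "((real m + 3/2) * real n + 1) / ((real m + 2) * real n)
        = (real m + 3/2) / (real m + 2) + 1 / (real m + 2) * (1 / real n)"
      using that by (simp add: add_divide_distrib)
    finally show ?thesis .
  qed
  \<comment> \<open>The competitive ratio does not depend on \<open>n\<close>, so letting the number
    of blocks grow removes the unit credited to the algorithm for the initial demand.\<close>
  have "(\<lambda>n. (real m + 3/2) / (real m + 2) + 1 / (real m + 2) * (1 / real n))
      \<longlonglongrightarrow> (real m + 3/2) / (real m + 2) + 1 / (real m + 2) * 0"
    by (intro tendsto_intros lim_1_over_n)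
  then have "(\<lambda>n. ereal ((real m + 3/2) / (real m + 2) + 1 / (real m + 2) * (1 / real n)))
      \<longlonglongrightarrow> ereal ((real m + 3/2) / (real m + 2))"
    by simp
  then have "competitive_ratio uniform_metric (drift_bounded_demands \<delta>) M A
      \<le> ereal ((real m + 3/2) / (real m + 2))"
    by (rule LIMSEQ_le_const) (use bound in blast)
  \<comment> \<open>The left side equals 1 - 1 / (2 (m + 2)), so this is exactly
    \<open>m_le\<close>.\<close>
  also have "(real m + 3/2) / (real m + 2) \<le> 1 - \<delta> / 4"
    using m_le by (simp add: field_simps)
  finally show ?thesis by simp
qed

end
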